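(* Let $n,m$ be positive integers, let $S\subseteq S_n$ be a subset of the symmetric group containing the identity, and let $G\le S_n$ be the subgroup generated by $S$. The player can win the $(S,m)$-game if and only if $|G|=1$, or $m=1$, or $(|G|,m)=(p^a,p^b)$ for some prime $p$ and positive integers $a,b$.
   Context: The $(S,m)$-game: $n$ counters sit at positions $1,\dots,n$ (labels fixed from the player's perspective), each showing an element of $\mathbb{Z}_m$, so a configuration is a vector in $\mathbb{Z}_m^n$. The initial configuration is arbitrary and unknown to the player. Each turn the player chooses a move $y\in\mathbb{Z}_m^n$, added coordinatewise to the configuration; then an arbitrary, adversarially chosen permutation $\sigma\in S$ (possibly different each turn) is applied to the counters: the configuration $x$ is replaced by $x'$ with $x'_{\sigma(i)}=x_i$ for all $i$. The player wins if at some moment (including initially) all counters show $0$. A strategy is a finite sequence of moves $y_1,\dots,y_N$ (the player receives no information); it is winning if for every initial configuration and every choice of permutations the configuration equals the zero vector at some time. "The player can win" means a winning finite sequence exists. *)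

theory Defs
  imports "HOL-Algebra.Sym_Groups" "HOL-Computational_Algebra.Primes"
begin

text \<open>Counters are at positions 1..n; a configuration in Z_m^n is a function
  nat => nat with values < m on {1..n} and value 0 outside {1..n}.\<close>

definition valid_config :: "nat \<Rightarrow> nat \<Rightarrow> (nat \<Rightarrow> nat) \<Rightarrow> bool" where
  "valid_config n m x \<longleftrightarrow> (\<forall>i\<in>{1..n}. x i < m) \<and> (\<forall>i. i \<notin> {1..n} \<longrightarrow> x i = 0)"

definition add_config :: "nat \<Rightarrow> (nat \<Rightarrow> nat) \<Rightarrow> (nat \<Rightarrow> nat) \<Rightarrow> (nat \<Rightarrow> nat)" where
  "add_config m x y = (\<lambda>i. (x i + y i) mod m)"

text \<open>Applying sigma: x' (sigma i) = x i, i.e. x' = x o inv sigma.\<close>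
definition perm_config :: "(nat \<Rightarrow> nat) \<Rightarrow> (nat \<Rightarrow> nat) \<Rightarrow> (nat \<Rightarrow> nat)" where
  "perm_config s x = x \<circ> Hilbert_Choice.inv s"

fun states :: "nat \<Rightarrow> (nat \<Rightarrow> nat) \<Rightarrow> (nat \<Rightarrow> nat) list \<Rightarrow> (nat \<Rightarrow> nat) list
      \<Rightarrow> (nat \<Rightarrow> nat) list" where
  "states m x (y # ys) (s # ss) = x # states m (perm_config s (add_config m x y)) ys ss"
| "states m x _ _ = [x]"

definition winning_strategy :: "nat \<Rightarrow> nat \<Rightarrow> (nat \<Rightarrow> nat) set \<Rightarrow> (nat \<Rightarrow> nat) list \<Rightarrow> bool" where
  "winning_strategy n m S ys \<longleftrightarrow>
     (\<forall>y\<in>set ys. valid_config n m y) \<and>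
     (\<forall>x ss. valid_config n m x \<and> length ss = length ys \<and> set ss \<subseteq> S
         \<longrightarrow> (\<lambda>_. 0) \<in> set (states m x ys ss))"

definition player_can_win :: "nat \<Rightarrow> nat \<Rightarrow> (nat \<Rightarrow> nat) set \<Rightarrow> bool" where
  "player_can_win n m S \<longleftrightarrow> (\<exists>ys. winning_strategy n m S ys)"

end

theory Submission
  imports
    Defs
    "HOL-Algebra.Multiplicative_Group"
    "HOL-Algebra.Sylow"
    "HOL-Algebra.Group_Action"
    "HOL-Number_Theory.Cong"
begin

text \<open>
  Moves and permutations act on the finite abelian group \<open>V\<close> of configurations, and the player wins
  iff \<open>V\<close> is the only invariant subgroup \<open>U\<close> for which \<open>V/U\<close> has no nonzero fixed element.

  If such a \<open>U\<close> is proper, every configuration outside \<open>U\<close> can be pulled back through any move to a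
  configuration outside \<open>U\<close>: otherwise all its images under \<open>S\<close> would agree modulo \<open>U\<close>. So the
  adversary stays outside \<open>U\<close>. Conversely, a strategy \<open>w\<close> for \<open>U\<close> and an element \<open>v\<close> that is fixed
  modulo \<open>U\<close> give the strategy \<open>w, -v, w, -v, \<dots>, w\<close> for the subgroup spanned by \<open>U\<close> and \<open>v\<close>.

  If \<open>|G|\<close> and \<open>m\<close> are powers of \<open>p\<close>, counting fixed points modulo \<open>p\<close> gives a nonzero fixed element
  in every nonzero \<open>V/U\<close>. If instead a prime \<open>q\<close> divides \<open>m\<close> and a prime \<open>r \<noteq> q\<close> divides \<open>|G|\<close>, the
  vectors fixed modulo \<open>q\<close> by all \<open>h\<close> in \<open>G\<close> with \<open>h\<^sup>r = 1\<close> form a proper subgroup of the above kind.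
\<close>

section \<open>Prime powers\<close>

lemma prime_dvd_if_dvd_prime_power:
  fixes p d :: nat
  assumes "prime p" "d dvd p ^ a" "d \<noteq> 1"
  shows "p dvd d"
proof -
  obtain i where "d = p ^ i"
    using assms(1,2) divides_primepow_nat by blast
  then show ?thesis
    using assms(3) by (cases i) auto
qed

lemma prime_power_if_unique_prime_divisor:
  fixes k q :: nat
  assumes "k \<noteq> 0" "k \<noteq> 1" "\<And>r. prime r \<Longrightarrow> r dvd k \<Longrightarrow> r = q"
  obtains a where "a > 0" "k = q ^ a"
proof -
  obtain r where "prime r" "r dvd k"
    using prime_factor_nat[OF assms(2)] by blast
  then have "prime_factors k = {q}"
    using assms by (auto simp: prime_factors_dvd)
  then have "k = q ^ multiplicity q k"
    using assms(1) prime_factorization_nat[of k] by simp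
  moreover from this have "multiplicity q k > 0"
    using assms(2) by (auto intro: gr0I)
  ultimately show thesis
    using that by blast
qed

lemma powers_of_same_prime_if_same_prime_divisors:
  fixes k m :: nat
  assumes "k \<noteq> 0" "k \<noteq> 1" "m \<noteq> 0" "m \<noteq> 1"
    and same: "\<And>q r. prime q \<Longrightarrow> q dvd m \<Longrightarrow> prime r \<Longrightarrow> r dvd k \<Longrightarrow> r = q"
  shows "\<exists>p a b. prime p \<and> a > 0 \<and> b > 0 \<and> k = p ^ a \<and> m = p ^ b"
proof -
  obtain q r where q: "prime q" "q dvd m" and r: "prime r" "r dvd k"
    using prime_factor_nat assms(2,4) by metis
  obtain a where a: "a > 0" "k = q ^ a"
    using prime_power_if_unique_prime_divisor[OF assms(1,2)] same q by metis
  obtain b where b: "b > 0" "m = q ^ b"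
    using prime_power_if_unique_prime_divisor[OF assms(3,4)] same q r by metis
  show ?thesis
    using q(1) a b by blast
qed


section \<open>Finite groups and group actions\<close>

lemma (in group) conj_nat_pow:
  assumes "g \<in> carrier G" "h \<in> carrier G"
  shows "(inv g \<otimes> h \<otimes> g) [^] (k :: nat) = inv g \<otimes> h [^] k \<otimes> g"
proof (induction k)
  case (Suc k)
  have "g \<otimes> (inv g \<otimes> (h \<otimes> g)) = h \<otimes> g"
    using assms by (metis inv_closed l_one m_assoc m_closed r_inv)
  then show ?case
    using Suc assms by (simp add: m_assoc)
qed (use assms in simp)

lemma (in group) cauchy_element:
  assumes "finite (carrier G)" "prime r" "r dvd order G"
  obtains g where "g \<in> carrier G" "g \<noteq> \<one>" "g [^] r = \<one>"
proof -
  obtain k where "order G = r ^ 1 * k"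
    using assms(3) by auto
  then obtain H where H: "subgroup H G" "card H = r"
    using sylow_thm[OF assms(2) is_group _ assms(1), of 1 k] by auto
  interpret H: group "G\<lparr>carrier := H\<rparr>"
    using H(1) by (rule subgroup_imp_group)
  have "H \<noteq> {\<one>}"
    using H(2) prime_gt_1_nat[OF assms(2)] by auto
  then obtain g where g: "g \<in> H" "g \<noteq> \<one>"
    using subgroup.one_closed[OF H(1)] by blast
  have "g [^]\<^bsub>G\<lparr>carrier := H\<rparr>\<^esub> r = \<one>"
    using H.pow_order_eq_1[of g] g H(2) by (simp add: order_def)
  then have "g [^] r = \<one>"
    by (simp add: nat_pow_consistent[symmetric])
  then show thesis
    using that g subgroup.mem_carrier[OF H(1)] by blast
qed

lemma (in group) set_mult_generate_conv_rcosets: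
  assumes "finite (carrier G)" "v \<in> carrier G"
  shows "U <#> generate G {v} = (\<Union>k\<le>ord v. U #> v [^] k)"
proof -
  have "ord v \<noteq> 0"
    using ord_ge_1[OF assms] by simp
  then have gen: "generate G {v} = {v [^] k |k. k \<in> (UNIV :: nat set)}"
    "generate G {v} = {v [^] k |k. k \<in> {0..ord v - 1}}"
    using generate_pow_nat ord_elems_inf_carrier assms(2) by simp_all
  show ?thesis
  proof
    show "U <#> generate G {v} \<subseteq> (\<Union>k\<le>ord v. U #> v [^] k)"
    proof
      fix x assume "x \<in> U <#> generate G {v}"
      then obtain u k where "u \<in> U" "x = u \<otimes> v [^] k" "k \<in> {0..ord v - 1}"
        unfolding gen(2) set_mult_def by blast
      then have "x \<in> U #> v [^] k" "k \<le> ord v"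
        by (auto simp: r_coset_def)
      then show "x \<in> (\<Union>k\<le>ord v. U #> v [^] k)"
        by blast
    qed
    show "(\<Union>k\<le>ord v. U #> v [^] k) \<subseteq> U <#> generate G {v}"
      unfolding gen(1) by (auto simp: set_mult_def r_coset_def)
  qed
qed

lemma (in group) insert_subset_set_mult_generate:
  assumes "subgroup U G" "v \<in> carrier G"
  shows "insert v U \<subseteq> U <#> generate G {v}"
proof
  fix x assume "x \<in> insert v U"
  moreover have "v = \<one> \<otimes> v" "\<one> \<in> U" "v \<in> generate G {v}" "\<one> \<in> generate G {v}"
    using assms by (simp_all add: generate.incl generate.one subgroup.one_closed)
  moreover have "x = x \<otimes> \<one>" if "x \<in> U"
    using that subgroup.mem_carrier[OF assms(1)] by simp
  ultimately show "x \<in> U <#> generate G {v}"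
    unfolding set_mult_def by blast
qed

lemma (in group) prime_dvd_card_rcosets:
  assumes "prime p" "order G = p ^ b" "subgroup U G" "U \<noteq> carrier G"
  shows "p dvd card (rcosets U)"
proof -
  have fin: "finite (carrier G)"
    using assms(1,2) order_gt_0_iff_finite prime_gt_0_nat by force
  have lagrange: "card (rcosets U) * card U = order G"
    using assms(3) by (rule lagrange)
  then have "card (rcosets U) dvd p ^ b"
    using assms(2) by (metis dvd_triv_left)
  moreover have "card (rcosets U) \<noteq> 1"
  proof
    assume "card (rcosets U) = 1"
    then have "card U = card (carrier G)"
      using lagrange by (simp add: order_def)
    then show False
      using assms(4) card_subset_eq[OF fin subgroup.subset[OF assms(3)]] by blast
  qed
  ultimately show ?thesis
    by (rule prime_dvd_if_dvd_prime_power[OF assms(1)])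
qed

lemma group_action_restrictI:
  fixes G (structure)
  assumes "group G"
    and closed: "\<And>g x. g \<in> carrier G \<Longrightarrow> x \<in> E \<Longrightarrow> f g x \<in> E"
    and one: "\<And>x. x \<in> E \<Longrightarrow> f \<one> x = x"
    and mult: "\<And>g h x. g \<in> carrier G \<Longrightarrow> h \<in> carrier G \<Longrightarrow> x \<in> E \<Longrightarrow> f (g \<otimes> h) x = f g (f h x)"
  shows "group_action G E (\<lambda>g. restrict (f g) E)"
proof -
  interpret group G by fact
  have bij: "restrict (f g) E \<in> Bij E" if g: "g \<in> carrier G" for g
  proof -
    have "f (inv g) (f g x) = x" "f g (f (inv g) x) = x" if "x \<in> E" for x
      using mult[of "inv g" g x] mult[of g "inv g" x] one that g by simp_all
    then have "bij_betw (f g) E E"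
      using closed g by (intro bij_betw_byWitness[where f' = "f (inv g)"]) auto
    then show ?thesis
      by (simp add: Bij_def cong: bij_betw_cong)
  qed
  have "restrict (f (g \<otimes> h)) E = compose E (restrict (f g) E) (restrict (f h) E)"
    if "g \<in> carrier G" "h \<in> carrier G" for g h
    using that closed mult by (auto simp: compose_def fun_eq_iff)
  then have "(\<lambda>g. restrict (f g) E) \<in> hom G (BijGroup E)"
    using bij by (auto simp: hom_def BijGroup_def)
  then show ?thesis
    by (simp add: group_action_def group_hom_def group_hom_axioms_def group_BijGroup is_group)
qed

context group_action
begin

definition fixed_points :: "'c set" where
  "fixed_points = {x \<in> E. \<forall>g\<in>carrier G. \<phi> g x = x}"

lemma orbit_eq_singleton_iff:
  assumes "x \<in> E"
  shows "orbit G \<phi> x = {x} \<longleftrightarrow> x \<in> fixed_points"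
  using orbit_refl[OF assms] assms by (auto simp: orbit_def fixed_points_def)

lemma prime_dvd_card_orbit:
  assumes "prime p" "order G = p ^ a" "x \<in> E" "x \<notin> fixed_points"
  shows "p dvd card (orbit G \<phi> x)"
proof -
  have "card (orbit G \<phi> x) dvd p ^ a"
    using orbit_stabilizer_theorem[OF assms(3)] assms(2) by (metis dvd_triv_left)
  moreover have "card (orbit G \<phi> x) \<noteq> 1"
    using orbit_refl[OF assms(3)] orbit_eq_singleton_iff[OF assms(3)] assms(4)
    by (metis card_1_singletonE singletonD)
  ultimately show ?thesis
    by (rule prime_dvd_if_dvd_prime_power[OF assms(1)])
qed

lemma card_fixed_points_cong:
  assumes "finite E" "prime p" "order G = p ^ a"
  shows "[card fixed_points = card E] (mod p)"
proof -
  let ?O = "orbits G E \<phi>" and ?F = "(\<lambda>x. {x}) ` fixed_points"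
  have F_sub: "?F \<subseteq> ?O"
    using orbit_eq_singleton_iff unfolding orbits_def fixed_points_def by blast
  have "p dvd card orb" if orb: "orb \<in> ?O - ?F" for orb
  proof -
    obtain x where x: "x \<in> E" "orb = orbit G \<phi> x"
      using orb unfolding orbits_def by blast
    then have "x \<notin> fixed_points"
      using orb orbit_eq_singleton_iff by blast
    then show ?thesis
      using x prime_dvd_card_orbit[OF assms(2,3)] by simp
  qed
  then have dvd: "p dvd (\<Sum>orb\<in>?O - ?F. card orb)"
    by (rule dvd_sum)
  have "card E = (\<Sum>orb\<in>?O. card orb)"
    using disjoint_sum[OF assms(1), of "\<lambda>_. 1 :: nat"] by simp
  also have "\<dots> = (\<Sum>orb\<in>?O - ?F. card orb) + (\<Sum>orb\<in>?F. card orb)"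
    using assms(1) by (intro sum.subset_diff F_sub) (simp add: orbits_def)
  also have "(\<Sum>orb\<in>?F. card orb) = card fixed_points"
    by (subst sum.reindex) (auto simp: inj_on_def)
  finally have "card E = (\<Sum>orb\<in>?O - ?F. card orb) + card fixed_points" .
  moreover have "[0 + card fixed_points = (\<Sum>orb\<in>?O - ?F. card orb) + card fixed_points] (mod p)"
    using dvd by (intro cong_add) (simp_all add: cong_0_iff cong_sym_eq[of 0])
  ultimately show ?thesis
    by simp
qed

end


section \<open>Abelian groups with a group of automorphisms\<close>

locale group_module = comm_group V + G: group G
    for V :: "('v, 'a) monoid_scheme" (structure) and G :: "('g, 'b) monoid_scheme" +
  fixes act :: "'g \<Rightarrow> 'v \<Rightarrow> 'v"
  assumes act_hom: "g \<in> carrier G \<Longrightarrow> act g \<in> hom V V"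
    and act_one [simp]: "v \<in> carrier V \<Longrightarrow> act \<one>\<^bsub>G\<^esub> v = v"
    and act_comp: "g \<in> carrier G \<Longrightarrow> h \<in> carrier G \<Longrightarrow> v \<in> carrier V \<Longrightarrow>
      act (g \<otimes>\<^bsub>G\<^esub> h) v = act g (act h v)"
begin

lemma group_hom_act: "g \<in> carrier G \<Longrightarrow> group_hom V V (act g)"
  using act_hom by unfold_locales

lemma act_closed [simp]: "g \<in> carrier G \<Longrightarrow> v \<in> carrier V \<Longrightarrow> act g v \<in> carrier V"
  using group_hom.hom_closed[OF group_hom_act] by blast

lemma act_m_mult [simp]:
  "g \<in> carrier G \<Longrightarrow> v \<in> carrier V \<Longrightarrow> w \<in> carrier V \<Longrightarrow> act g (v \<otimes> w) = act g v \<otimes> act g w"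
  using act_hom by (rule hom_mult)

lemma act_m_inv [simp]: "g \<in> carrier G \<Longrightarrow> v \<in> carrier V \<Longrightarrow> act g (inv v) = inv (act g v)"
  using group_hom.hom_inv[OF group_hom_act] by blast

lemma act_G_inv [simp]:
  assumes "g \<in> carrier G" "v \<in> carrier V"
  shows "act (inv\<^bsub>G\<^esub> g) (act g v) = v" "act g (act (inv\<^bsub>G\<^esub> g) v) = v"
  using assms by (simp_all flip: act_comp)

lemma group_module_subgroup:
  assumes "subgroup H G"
  shows "group_module V (G\<lparr>carrier := H\<rparr>) act"
proof -
  interpret H: group "G\<lparr>carrier := H\<rparr>"
    using assms by (rule G.subgroup_imp_group)
  show ?thesis
    using subgroup.mem_carrier[OF assms] by unfold_locales (auto simp: act_hom act_comp)
qed

definition displacement :: "'g \<Rightarrow> 'v \<Rightarrow> 'v" where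
  "displacement g v = act g v \<otimes> inv v"

lemma displacement_closed [simp]:
  "g \<in> carrier G \<Longrightarrow> v \<in> carrier V \<Longrightarrow> displacement g v \<in> carrier V"
  by (simp add: displacement_def)

lemma displacement_mult_self:
  "g \<in> carrier G \<Longrightarrow> v \<in> carrier V \<Longrightarrow> displacement g v \<otimes> v = act g v"
  by (simp add: displacement_def m_assoc)

lemma displacement_one [simp]: "v \<in> carrier V \<Longrightarrow> displacement \<one>\<^bsub>G\<^esub> v = \<one>"
  by (simp add: displacement_def)

lemma group_hom_displacement:
  assumes "g \<in> carrier G"
  shows "group_hom V V (displacement g)"
proof (unfold_locales, rule homI)
  show "displacement g (v \<otimes> w) = displacement g v \<otimes> displacement g w"
    if "v \<in> carrier V" "w \<in> carrier V" for v w
    using that assms by (simp add: displacement_def inv_mult m_ac)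
qed (use assms in simp)

lemma displacement_comp:
  assumes "g \<in> carrier G" "h \<in> carrier G" "v \<in> carrier V"
  shows "displacement (g \<otimes>\<^bsub>G\<^esub> h) v = act g (displacement h v) \<otimes> displacement g v"
proof -
  have "act g (displacement h v) \<otimes> displacement g v \<otimes> v = displacement (g \<otimes>\<^bsub>G\<^esub> h) v \<otimes> v"
    using assms by (simp add: m_assoc displacement_mult_self act_comp flip: act_m_mult)
  then show ?thesis
    using assms by simp
qed

lemma displacement_act:
  assumes "g \<in> carrier G" "h \<in> carrier G" "v \<in> carrier V"
  shows "displacement h (act g v) = act g (displacement (inv\<^bsub>G\<^esub> g \<otimes>\<^bsub>G\<^esub> h \<otimes>\<^bsub>G\<^esub> g) v)"
  using assms by (simp add: displacement_def act_comp)

definition invariant_subgroup :: "'v set \<Rightarrow> bool" where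
  "invariant_subgroup U \<longleftrightarrow> subgroup U V \<and> (\<forall>g\<in>carrier G. \<forall>u\<in>U. act g u \<in> U)"

definition fixed_mod :: "'g set \<Rightarrow> 'v set \<Rightarrow> 'v set" where
  "fixed_mod T U = {v \<in> carrier V. \<forall>g\<in>T. displacement g v \<in> U}"

text \<open>
  As \<open>fixed_mod (carrier G) U / U\<close> consists of the fixed elements of \<open>V/U\<close>, the condition says that
  every nonzero quotient module of \<open>V\<close> has a nonzero fixed element.
\<close>

definition hypercentral_action :: bool where
  "hypercentral_action \<longleftrightarrow>
    (\<forall>U. invariant_subgroup U \<longrightarrow> fixed_mod (carrier G) U \<subseteq> U \<longrightarrow> U = carrier V)"

lemma subgroup_if_invariant: "invariant_subgroup U \<Longrightarrow> subgroup U V"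
  by (simp add: invariant_subgroup_def)

lemma act_mem_invariant: "invariant_subgroup U \<Longrightarrow> g \<in> carrier G \<Longrightarrow> u \<in> U \<Longrightarrow> act g u \<in> U"
  by (simp add: invariant_subgroup_def)

lemma invariant_subgroup_one: "invariant_subgroup {\<one>}"
  using triv_subgroup group_hom.hom_one[OF group_hom_act] by (simp add: invariant_subgroup_def)

lemma subgroup_displacement_mem:
  assumes "invariant_subgroup U" "v \<in> carrier V"
  shows "subgroup {g \<in> carrier G. displacement g v \<in> U} G"
proof -
  interpret U: subgroup U V
    using assms(1) by (rule subgroup_if_invariant)
  show ?thesis
  proof (rule G.subgroupI)
    show "inv\<^bsub>G\<^esub> g \<in> {g \<in> carrier G. displacement g v \<in> U}"
      if "g \<in> {g \<in> carrier G. displacement g v \<in> U}" for g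
    proof -
      have g: "g \<in> carrier G" "act (inv\<^bsub>G\<^esub> g) (displacement g v) \<in> U"
        using that act_mem_invariant[OF assms(1)] by auto
      have "act (inv\<^bsub>G\<^esub> g) (displacement g v) \<otimes> displacement (inv\<^bsub>G\<^esub> g) v = \<one>"
        using assms(2) g(1) displacement_comp[of "inv\<^bsub>G\<^esub> g" g v] by simp
      then have "displacement (inv\<^bsub>G\<^esub> g) v = inv (act (inv\<^bsub>G\<^esub> g) (displacement g v))"
        using assms(2) g(1)
        by (metis G.inv_closed act_closed displacement_closed inv_equality inv_inv)
      then show ?thesis
        using g by simp
    qed
  next
    show "{g \<in> carrier G. displacement g v \<in> U} \<noteq> {}"
      using assms(2) by (auto intro!: exI[of _ "\<one>\<^bsub>G\<^esub>"])
  qed (use assms act_mem_invariant[OF assms(1)] in \<open>auto simp: displacement_comp\<close>)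
qed

lemma fixed_mod_generate:
  assumes "S \<subseteq> carrier G" "invariant_subgroup U"
  shows "fixed_mod (generate G S) U = fixed_mod S U"
proof
  show "fixed_mod (generate G S) U \<subseteq> fixed_mod S U"
    by (auto simp: fixed_mod_def generate.incl)
  show "fixed_mod S U \<subseteq> fixed_mod (generate G S) U"
  proof
    fix v assume v: "v \<in> fixed_mod S U"
    then have "S \<subseteq> {g \<in> carrier G. displacement g v \<in> U}"
      using assms(1) by (auto simp: fixed_mod_def)
    then have "generate G S \<subseteq> {g \<in> carrier G. displacement g v \<in> U}"
      using v assms(2)
      by (intro G.generate_subgroup_incl subgroup_displacement_mem) (auto simp: fixed_mod_def)
    then show "v \<in> fixed_mod (generate G S) U"
      using v by (auto simp: fixed_mod_def)
  qed
qed

lemma invariant_subgroup_fixed_mod: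
  assumes U: "invariant_subgroup U" and T: "T \<subseteq> carrier G"
    and conj: "\<And>g h. g \<in> carrier G \<Longrightarrow> h \<in> T \<Longrightarrow> inv\<^bsub>G\<^esub> g \<otimes>\<^bsub>G\<^esub> h \<otimes>\<^bsub>G\<^esub> g \<in> T"
  shows "invariant_subgroup (fixed_mod T U)"
proof -
  interpret U: subgroup U V
    using U by (rule subgroup_if_invariant)
  note displacement_hom =
    group_hom.hom_mult[OF group_hom_displacement] group_hom.hom_inv[OF group_hom_displacement]
    group_hom.hom_one[OF group_hom_displacement]
  have "subgroup (fixed_mod T U) V"
    using T by (intro subgroupI) (auto simp: fixed_mod_def displacement_hom subset_iff)
  moreover have "act g v \<in> fixed_mod T U" if g: "g \<in> carrier G" and v: "v \<in> fixed_mod T U" for g v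
  proof -
    have "displacement h (act g v) \<in> U" if h: "h \<in> T" for h
    proof -
      have "displacement (inv\<^bsub>G\<^esub> g \<otimes>\<^bsub>G\<^esub> h \<otimes>\<^bsub>G\<^esub> g) v \<in> U"
        using v conj[OF g h] by (simp add: fixed_mod_def)
      then have "act g (displacement (inv\<^bsub>G\<^esub> g \<otimes>\<^bsub>G\<^esub> h \<otimes>\<^bsub>G\<^esub> g) v) \<in> U"
        using act_mem_invariant[OF U g] by blast
      then show ?thesis
        using g v T h by (subst displacement_act) (auto simp: fixed_mod_def)
    qed
    then show ?thesis
      using g v by (simp add: fixed_mod_def)
  qed
  ultimately show ?thesis
    by (simp add: invariant_subgroup_def)
qed

lemma nat_pow_mem_fixed_mod:
  assumes "invariant_subgroup U" "v \<in> fixed_mod (carrier G) U"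
  shows "v [^] (k :: nat) \<in> fixed_mod (carrier G) U"
proof -
  interpret F: subgroup "fixed_mod (carrier G) U" V
    using assms(1) by (intro subgroup_if_invariant invariant_subgroup_fixed_mod) auto
  show ?thesis
    using assms(2) by (induction k) auto
qed

lemma act_image_rcoset:
  assumes "invariant_subgroup U" "g \<in> carrier G" "x \<in> carrier V"
  shows "act g ` (U #> x) = U #> act g x"
proof -
  have UV: "u \<in> carrier V" if "u \<in> U" for u
    using that subgroup.mem_carrier[OF subgroup_if_invariant[OF assms(1)]] by blast
  have "U \<subseteq> act g ` U"
  proof
    fix u assume u: "u \<in> U"
    then have "u = act g (act (inv\<^bsub>G\<^esub> g) u)"
      using assms(2) UV by simp
    then show "u \<in> act g ` U"
      using u assms(2) act_mem_invariant[OF assms(1)] by (metis G.inv_closed image_eqI)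
  qed
  then have act_U: "act g ` U = U"
    using assms(2) act_mem_invariant[OF assms(1)] by blast
  have "act g ` (U #> x) = (\<lambda>u. act g (u \<otimes> x)) ` U"
    by (auto simp: r_coset_def)
  also have "\<dots> = (\<lambda>u. act g u \<otimes> act g x) ` U"
    using assms(2,3) UV by (intro image_cong) simp_all
  also have "\<dots> = act g ` U #> act g x"
    by (auto simp: r_coset_def)
  finally show ?thesis
    by (simp only: act_U)
qed

lemma act_image_rcoset_eq_iff:
  assumes "invariant_subgroup U" "g \<in> carrier G" "x \<in> carrier V"
  shows "act g ` (U #> x) = U #> x \<longleftrightarrow> displacement g x \<in> U"
proof -
  have U: "subgroup U V"
    using assms(1) by (rule subgroup_if_invariant)
  have "act g ` (U #> x) = U #> x \<longleftrightarrow> act g x \<in> U #> x"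
    using act_image_rcoset[OF assms] repr_independence[OF _ assms(3) U] rcos_self[OF _ U] assms(2,3)
    by (metis act_closed)
  also have "\<dots> \<longleftrightarrow> displacement g x \<in> U"
    using subgroup.rcos_module[OF U is_group] assms(2,3) by (simp add: displacement_def)
  finally show ?thesis .
qed

lemma act_mem_rcoset:
  assumes U: "invariant_subgroup U" and w: "w \<in> fixed_mod (carrier G) U"
    and "g \<in> carrier G" "x \<in> U #> w"
  shows "act g x \<in> U #> w"
proof -
  have "act g ` (U #> w) = U #> w"
    using act_image_rcoset_eq_iff[OF U] w assms(3) by (simp add: fixed_mod_def)
  then show ?thesis
    using assms(4) by blast
qed

lemma invariant_subgroup_set_mult_generate:
  assumes "finite (carrier V)" and U: "invariant_subgroup U"
    and v: "v \<in> fixed_mod (carrier G) U"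
  shows "invariant_subgroup (U <#> generate V {v})"
proof -
  have vV: "v \<in> carrier V" and subU: "subgroup U V"
    using v subgroup_if_invariant[OF U] by (simp_all add: fixed_mod_def)
  have "subgroup (U <#> generate V {v}) V"
    using vV by (intro mult_subgroups subU generate_is_subgroup) simp
  moreover have "act g x \<in> U <#> generate V {v}"
    if "g \<in> carrier G" "x \<in> U <#> generate V {v}" for g x
    using that act_mem_rcoset[OF U nat_pow_mem_fixed_mod[OF U v]]
    by (auto simp: set_mult_generate_conv_rcosets[OF assms(1) vV])
  ultimately show ?thesis
    by (simp add: invariant_subgroup_def)
qed

lemma group_action_rcosets:
  assumes "invariant_subgroup U"
  shows "group_action G (rcosets U) (\<lambda>g. restrict ((`) (act g)) (rcosets U))"
proof (rule group_action_restrictI)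
  have U_sub: "U \<subseteq> carrier V"
    using assms by (intro subgroup.subset subgroup_if_invariant)
  have rcoset_sub: "c \<subseteq> carrier V" if "c \<in> rcosets U" for c
    using that U_sub by (auto simp: RCOSETS_def r_coset_def)
  show "act g ` c \<in> rcosets U" if "g \<in> carrier G" "c \<in> rcosets U" for g c
    using that act_image_rcoset[OF assms] rcosetsI[OF U_sub] by (auto simp: RCOSETS_def)
  show "act \<one>\<^bsub>G\<^esub> ` c = c" if "c \<in> rcosets U" for c
    using act_one rcoset_sub[OF that] by (simp add: subset_iff)
  show "act (g \<otimes>\<^bsub>G\<^esub> h) ` c = act g ` act h ` c"
    if "g \<in> carrier G" "h \<in> carrier G" "c \<in> rcosets U" for g h c
    using act_comp[OF that(1,2)] rcoset_sub[OF that(3)]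
    by (simp add: image_image subset_iff cong: image_cong)
qed (rule G.is_group)

lemma fixed_points_rcosets:
  assumes U: "invariant_subgroup U"
  shows "group_action.fixed_points G (rcosets U) (\<lambda>g. restrict ((`) (act g)) (rcosets U)) =
    (\<lambda>x. U #> x) ` fixed_mod (carrier G) U"
proof -
  interpret rcosets: group_action G "rcosets U" "\<lambda>g. restrict ((`) (act g)) (rcosets U)"
    using U by (rule group_action_rcosets)
  have fixed_iff: "U #> x \<in> rcosets.fixed_points \<longleftrightarrow> x \<in> fixed_mod (carrier G) U"
    if "x \<in> carrier V" for x
    using that act_image_rcoset_eq_iff[OF U]
      rcosetsI[OF subgroup.subset[OF subgroup_if_invariant[OF U]]]
    by (simp add: rcosets.fixed_points_def fixed_mod_def)
  show ?thesis
  proof (intro equalityI subsetI)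
    fix c assume c: "c \<in> rcosets.fixed_points"
    then have "c \<in> rcosets U"
      by (simp add: rcosets.fixed_points_def)
    then obtain x where "x \<in> carrier V" "c = U #> x"
      by (auto simp: RCOSETS_def)
    then show "c \<in> (\<lambda>x. U #> x) ` fixed_mod (carrier G) U"
      using c fixed_iff by blast
  next
    fix c assume "c \<in> (\<lambda>x. U #> x) ` fixed_mod (carrier G) U"
    then obtain x where "x \<in> fixed_mod (carrier G) U" "c = U #> x"
      by blast
    then show "c \<in> rcosets.fixed_points"
      using fixed_iff by (simp add: fixed_mod_def)
  qed
qed

theorem hypercentral_action_if_p_groups:
  assumes "prime p" "order G = p ^ a" "order V = p ^ b"
  shows "hypercentral_action"
  unfolding hypercentral_action_def
proof (intro allI impI, rule ccontr)
  fix U assume U: "invariant_subgroup U" and closed: "fixed_mod (carrier G) U \<subseteq> U"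
    and proper: "U \<noteq> carrier V"
  have subU: "subgroup U V"
    using U by (rule subgroup_if_invariant)
  interpret rcosets: group_action G "rcosets U" "\<lambda>g. restrict ((`) (act g)) (rcosets U)"
    using U by (rule group_action_rcosets)
  have dvd: "p dvd card (rcosets U)"
    using prime_dvd_card_rcosets[OF assms(1,3) subU proper] .
  have "\<one> \<in> fixed_mod (carrier G) U"
    using group_hom.hom_one[OF group_hom_displacement] subgroup.one_closed[OF subU]
    by (simp add: fixed_mod_def)
  moreover have "U #> x = U" if "x \<in> fixed_mod (carrier G) U" for x
    using that closed by (intro coset_join2 subU) (auto simp: fixed_mod_def)
  ultimately have "rcosets.fixed_points = {U}"
    unfolding fixed_points_rcosets[OF U] by blast
  then have "card rcosets.fixed_points = 1"
    by simp
  moreover have "finite (rcosets U)"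
    using lagrange[OF subU] assms(1,3) by (intro card_ge_0_finite) (auto intro!: gr0I)
  ultimately have "[1 = card (rcosets U)] (mod p)"
    using rcosets.card_fixed_points_cong[OF _ assms(1,2)] by metis
  then have "p dvd 1"
    using dvd by (simp only: cong_dvd_iff)
  then show False
    using assms(1) by auto
qed

lemma hypercentral_action_if_trivial_group:
  assumes "order G = 1"
  shows "hypercentral_action"
proof -
  have "carrier G = {\<one>\<^bsub>G\<^esub>}"
    using assms G.one_closed unfolding order_def by (metis card_1_singletonE singletonD)
  then have "fixed_mod (carrier G) U = carrier V" if "invariant_subgroup U" for U
    using subgroup.one_closed[OF subgroup_if_invariant[OF that]] by (auto simp: fixed_mod_def)
  then show ?thesis
    using subgroup.subset[OF subgroup_if_invariant] by (auto simp: hypercentral_action_def)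
qed

lemma hypercentral_action_if_trivial_module:
  assumes "order V = 1"
  shows "hypercentral_action"
proof -
  have V: "carrier V = {\<one>}"
    using assms one_closed unfolding order_def by (metis card_1_singletonE singletonD)
  have "U = carrier V" if "subgroup U V" for U
    using subgroup.subset[OF that] subgroup.one_closed[OF that] by (auto simp: V)
  then show ?thesis
    by (simp add: hypercentral_action_def subgroup_if_invariant)
qed

definition torsion :: "nat \<Rightarrow> 'g set" where
  "torsion r = {h \<in> carrier G. h [^]\<^bsub>G\<^esub> r = \<one>\<^bsub>G\<^esub>}"

lemma nat_pow_mem_torsion:
  assumes "h \<in> torsion r"
  shows "h [^]\<^bsub>G\<^esub> (k :: nat) \<in> torsion r"
proof -
  have "h \<in> carrier G"
    using assms by (simp add: torsion_def)
  then have "(h [^]\<^bsub>G\<^esub> k) [^]\<^bsub>G\<^esub> r = (h [^]\<^bsub>G\<^esub> r) [^]\<^bsub>G\<^esub> k"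
    by (simp add: G.nat_pow_pow mult.commute)
  then show ?thesis
    using assms by (simp add: torsion_def)
qed

lemma displacement_nat_pow_mem_rcoset:
  assumes W: "subgroup W V" and hv: "h \<in> carrier G" "v \<in> carrier V"
    and fixed: "\<And>k :: nat. displacement (h [^]\<^bsub>G\<^esub> k) (displacement h v) \<in> W"
  shows "displacement (h [^]\<^bsub>G\<^esub> k) v \<in> W #> displacement h v [^] (k :: nat)"
proof (induction k)
  case 0
  then show ?case
    using hv rcos_self[OF one_closed W] by simp
next
  case (Suc k)
  interpret W: subgroup W V
    by (rule W)
  define w where "w = displacement h v"
  have w: "w \<in> carrier V"
    using hv by (simp add: w_def)
  obtain u where u: "u \<in> W" "displacement (h [^]\<^bsub>G\<^esub> k) v = u \<otimes> w [^] k"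
    using Suc by (auto simp: r_coset_def w_def)
  have "displacement (h [^]\<^bsub>G\<^esub> Suc k) v
      = (displacement (h [^]\<^bsub>G\<^esub> k) w \<otimes> w) \<otimes> displacement (h [^]\<^bsub>G\<^esub> k) v"
    using hv w by (simp add: displacement_comp displacement_mult_self flip: w_def)
  also have "\<dots> = (displacement (h [^]\<^bsub>G\<^esub> k) w \<otimes> u) \<otimes> w [^] Suc k"
    using u w hv by (simp add: m_ac)
  also have "\<dots> \<in> W #> w [^] Suc k"
    using fixed[of k] u(1) w by (intro rcosI W.subset W.m_closed) (simp_all add: w_def)
  finally show ?case
    by (simp add: w_def)
qed

text \<open>
  If \<open>h\<close> moves \<open>v\<close> by an amount \<open>w\<close> that \<open>h\<close> fixes modulo \<open>W\<close>, then \<open>h\<^sup>k\<close> moves \<open>v\<close> by \<open>k w\<close> modulo \<open>W\<close>,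
  so \<open>h\<^sup>r = 1\<close> forces \<open>r w \<in> W\<close>.
\<close>

lemma fixed_mod_fixed_mod_torsion_subset:
  assumes W: "invariant_subgroup W" and root: "\<And>w. w \<in> carrier V \<Longrightarrow> w [^] r \<in> W \<Longrightarrow> w \<in> W"
  shows "fixed_mod (carrier G) (fixed_mod (torsion r) W) \<subseteq> fixed_mod (torsion r) W"
proof
  fix v assume v: "v \<in> fixed_mod (carrier G) (fixed_mod (torsion r) W)"
  interpret W: subgroup W V
    using W by (rule subgroup_if_invariant)
  have vV: "v \<in> carrier V"
    using v by (simp add: fixed_mod_def)
  have "displacement h v \<in> W" if h: "h \<in> torsion r" for h
  proof -
    have hG: "h \<in> carrier G" and h_r: "h [^]\<^bsub>G\<^esub> r = \<one>\<^bsub>G\<^esub>"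
      using h by (simp_all add: torsion_def)
    have w: "displacement h v \<in> carrier V"
      using hG vV by simp
    have "displacement h v \<in> fixed_mod (torsion r) W"
      using v hG by (simp add: fixed_mod_def)
    then have "displacement (h [^]\<^bsub>G\<^esub> k) (displacement h v) \<in> W" for k :: nat
      using nat_pow_mem_torsion[OF h, of k] by (simp add: fixed_mod_def)
    then have "displacement (h [^]\<^bsub>G\<^esub> r) v \<in> W #> displacement h v [^] r"
      by (rule displacement_nat_pow_mem_rcoset[OF W.subgroup_axioms hG vV])
    then have "\<one> \<otimes> inv (displacement h v [^] r) \<in> W"
      using W.rcos_module_imp[OF is_group nat_pow_closed[OF w]] vV by (simp add: h_r)
    then have "displacement h v [^] r \<in> W"
      using w W.m_inv_closed by fastforce
    then show ?thesis
      by (rule root[OF w])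
  qed
  then show "v \<in> fixed_mod (torsion r) W"
    using vV by (simp add: fixed_mod_def)
qed

theorem hypercentral_action_torsion_trivial:
  assumes "hypercentral_action" "invariant_subgroup W"
    and "\<And>w. w \<in> carrier V \<Longrightarrow> w [^] r \<in> W \<Longrightarrow> w \<in> W"
    and "h \<in> torsion r" "v \<in> carrier V"
  shows "displacement h v \<in> W"
proof -
  have "invariant_subgroup (fixed_mod (torsion r) W)"
    by (intro invariant_subgroup_fixed_mod assms(2)) (auto simp: torsion_def G.conj_nat_pow)
  then have "fixed_mod (torsion r) W = carrier V"
    using assms(1) fixed_mod_fixed_mod_torsion_subset[OF assms(2,3)]
    by (simp add: hypercentral_action_def)
  then show ?thesis
    using assms(4,5) by (auto simp: fixed_mod_def)
qed

end


section \<open>The game on a finite module\<close>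

locale module_game = group_module V G act
    for V :: "('v, 'a) monoid_scheme" (structure) and G :: "('g, 'b) monoid_scheme" and act +
  fixes S :: "'g set"
  assumes finite_V: "finite (carrier V)"
    and generate_S: "generate G S = carrier G"
    and one_mem_S: "\<one>\<^bsub>G\<^esub> \<in> S"
begin

primrec forces_win :: "'v list \<Rightarrow> 'v \<Rightarrow> bool" where
  "forces_win [] x \<longleftrightarrow> x = \<one>"
| "forces_win (y # ys) x \<longleftrightarrow> x = \<one> \<or> (\<forall>s\<in>S. forces_win ys (act s (x \<otimes> y)))"

definition winnable :: "'v set \<Rightarrow> bool" where
  "winnable U \<longleftrightarrow> (\<exists>ys. set ys \<subseteq> U \<and> (\<forall>x\<in>U. forces_win ys x))"

lemma S_subset: "S \<subseteq> carrier G"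
  unfolding generate_S[symmetric] by (auto intro: generate.incl)

lemma fixed_mod_S: "invariant_subgroup U \<Longrightarrow> fixed_mod S U = fixed_mod (carrier G) U"
  using fixed_mod_generate[OF S_subset] by (simp add: generate_S)

lemma predecessor_outside:
  assumes U: "invariant_subgroup U" "fixed_mod (carrier G) U \<subseteq> U"
    and x: "x \<in> carrier V - U" and y: "y \<in> carrier V"
  obtains z s where "z \<in> carrier V - U" "s \<in> S" "act s (z \<otimes> y) = x"
proof -
  interpret U: subgroup U V
    using U(1) by (rule subgroup_if_invariant)
  have "x \<notin> fixed_mod S U"
    using x U(2) fixed_mod_S[OF U(1)] by blast
  then obtain s where s: "s \<in> S" "displacement s x \<notin> U"
    using x by (auto simp: fixed_mod_def)
  have sG: "s \<in> carrier G"
    using s(1) S_subset by blast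
  define pre where "pre t = act (inv\<^bsub>G\<^esub> t) x \<otimes> inv y" for t
  have pre: "pre t \<in> carrier V" "act t (pre t \<otimes> y) = x" if "t \<in> S" for t
    using that S_subset x y by (auto simp: pre_def m_assoc)
  have "pre s \<notin> U \<or> pre \<one>\<^bsub>G\<^esub> \<notin> U"
  proof (rule ccontr)
    assume "\<not> ?thesis"
    then have "pre \<one>\<^bsub>G\<^esub> \<otimes> inv (pre s) \<in> U"
      by simp
    moreover have "pre \<one>\<^bsub>G\<^esub> = x \<otimes> inv (act (inv\<^bsub>G\<^esub> s) x) \<otimes> pre s"
      using x y sG by (simp add: pre_def m_assoc inv_solve_left)
    then have "pre \<one>\<^bsub>G\<^esub> \<otimes> inv (pre s) = x \<otimes> inv (act (inv\<^bsub>G\<^esub> s) x)"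
      using x sG pre(1) s(1) one_mem_S by (intro inv_solve_right'[THEN iffD2]) simp_all
    ultimately have "act s (x \<otimes> inv (act (inv\<^bsub>G\<^esub> s) x)) \<in> U"
      using act_mem_invariant[OF U(1) sG] by simp
    then show False
      using s(2) sG x by (simp add: displacement_def)
  qed
  then show thesis
    using that pre s(1) one_mem_S by blast
qed

lemma exists_position_not_forced:
  assumes U: "invariant_subgroup U" "fixed_mod (carrier G) U \<subseteq> U" "U \<noteq> carrier V"
    and "set ys \<subseteq> carrier V"
  shows "\<exists>x\<in>carrier V - U. \<not> forces_win ys x"
  using assms(4)
proof (induction ys)
  case Nil
  have "U \<subseteq> carrier V" "\<one> \<in> U"
    using subgroup_if_invariant[OF U(1)] by (auto intro: subgroup.one_closed subgroup.mem_carrier)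
  then obtain x where "x \<in> carrier V - U" "x \<noteq> \<one>"
    using U(3) by blast
  then show ?case
    by auto
next
  case (Cons y ys)
  then obtain x where x: "x \<in> carrier V - U" "\<not> forces_win ys x" and y: "y \<in> carrier V"
    by auto
  obtain z s where z: "z \<in> carrier V - U" and s: "s \<in> S" "act s (z \<otimes> y) = x"
    using predecessor_outside[OF U(1,2) x(1) y] .
  have "z \<noteq> \<one>"
    using z subgroup.one_closed[OF subgroup_if_invariant[OF U(1)]] by auto
  then have "\<not> forces_win (y # ys) z"
    using s x(2) by auto
  then show ?case
    using z by blast
qed

lemma forces_win_one: "forces_win ys \<one>"
  by (cases ys) simp_all

lemma forces_win_append: "forces_win ys x \<Longrightarrow> forces_win (ys @ zs) x"
  by (induction ys arbitrary: x) (auto simp: forces_win_one)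

lemma forces_win_append_invariant:
  assumes "x \<in> P" and "\<And>x y s. x \<in> P \<Longrightarrow> y \<in> set ys \<Longrightarrow> s \<in> S \<Longrightarrow> act s (x \<otimes> y) \<in> P"
    and "\<And>x. x \<in> P \<Longrightarrow> forces_win zs x"
  shows "forces_win (ys @ zs) x"
  using assms(1,2)
proof (induction ys arbitrary: x)
  case Nil
  then show ?case
    using assms(3) by simp
next
  case (Cons y ys)
  then have "forces_win (ys @ zs) (act s (x \<otimes> y))" if "s \<in> S" for s
    using that by simp
  then show ?case
    by simp
qed

lemma move_mem_rcoset:
  assumes U: "invariant_subgroup U" and w: "w \<in> fixed_mod (carrier G) U"
    and "x \<in> U #> w" "y \<in> U" "s \<in> S"
  shows "act s (x \<otimes> y) \<in> U #> w"
proof -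
  interpret U: subgroup U V
    using U by (rule subgroup_if_invariant)
  obtain u where u: "u \<in> U" "x = u \<otimes> w"
    using assms(3) by (auto simp: r_coset_def)
  then have "x \<otimes> y = (u \<otimes> y) \<otimes> w"
    using w assms(4) by (simp add: fixed_mod_def m_ac)
  also have "\<dots> \<in> U #> w"
    using u(1) w assms(4) by (intro rcosI U.subset) (simp_all add: fixed_mod_def)
  finally show ?thesis
    using S_subset assms(5) by (intro act_mem_rcoset U w) auto
qed

lemma inv_move_mem_rcoset:
  assumes U: "invariant_subgroup U" and v: "v \<in> fixed_mod (carrier G) U"
    and "x \<in> U #> v [^] Suc k" "s \<in> S"
  shows "act s (x \<otimes> inv v) \<in> U #> v [^] k"
proof -
  interpret U: subgroup U V
    using U by (rule subgroup_if_invariant)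
  have vV: "v \<in> carrier V"
    using v by (simp add: fixed_mod_def)
  obtain u where u: "u \<in> U" "x = u \<otimes> v [^] Suc k"
    using assms(3) unfolding r_coset_def by blast
  then have "x \<otimes> inv v = u \<otimes> v [^] k"
    using vV by (simp add: m_assoc)
  also have "\<dots> \<in> U #> v [^] k"
    using u(1) vV by (intro rcosI U.subset) simp_all
  finally show ?thesis
    using S_subset assms(4) by (intro act_mem_rcoset nat_pow_mem_fixed_mod U v) auto
qed

lemma forces_win_alternating:
  assumes U: "invariant_subgroup U" and v: "v \<in> fixed_mod (carrier G) U"
    and ys: "set ys \<subseteq> U" "\<And>x. x \<in> U \<Longrightarrow> forces_win ys x"
    and "x \<in> U #> v [^] j" "j \<le> k"
  shows "forces_win (concat (replicate k (ys @ [inv v])) @ ys) x"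
  using assms(5,6)
proof (induction k arbitrary: x j)
  case 0
  then show ?case
    using ys(2) coset_mult_one subgroup.subset[OF subgroup_if_invariant[OF U]] by simp
next
  case (Suc k)
  let ?zs = "concat (replicate k (ys @ [inv v])) @ ys"
  have "forces_win (ys @ inv v # ?zs) x"
  proof (cases j)
    case 0
    then show ?thesis
      using Suc.prems(1) ys(2) coset_mult_one subgroup.subset[OF subgroup_if_invariant[OF U]]
      by (intro forces_win_append) simp
  next
    case (Suc i)
    show ?thesis
    proof (rule forces_win_append_invariant[OF Suc.prems(1)])
      show "act s (z \<otimes> y) \<in> U #> v [^] j"
        if "z \<in> U #> v [^] j" "y \<in> set ys" "s \<in> S" for z y s
        using that ys(1) by (intro move_mem_rcoset nat_pow_mem_fixed_mod U v) auto
      show "forces_win (inv v # ?zs) z" if "z \<in> U #> v [^] j" for z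
        using that inv_move_mem_rcoset[OF U v, of z i] Suc Suc.prems(2) Suc.IH[of _ i] by simp
    qed
  qed
  then show ?case
    by simp
qed

lemma winnable_one: "winnable {\<one>}"
  unfolding winnable_def by (intro exI[of _ "[]"]) simp

lemma winnable_set_mult_generate:
  assumes U: "invariant_subgroup U" "winnable U" and v: "v \<in> fixed_mod (carrier G) U"
  shows "winnable (U <#> generate V {v})"
proof -
  let ?W = "U <#> generate V {v}"
  obtain ys where ys: "set ys \<subseteq> U" "\<And>x. x \<in> U \<Longrightarrow> forces_win ys x"
    using U(2) by (auto simp: winnable_def)
  let ?zs = "concat (replicate (ord v) (ys @ [inv v])) @ ys"
  have vV: "v \<in> carrier V" and subU: "subgroup U V"
    using v subgroup_if_invariant[OF U(1)] by (simp_all add: fixed_mod_def)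
  have sub: "v \<in> ?W" "U \<subseteq> ?W"
    using insert_subset_set_mult_generate[OF subU vV] by simp_all
  have "inv v \<in> ?W"
    using subgroup_if_invariant[OF invariant_subgroup_set_mult_generate[OF finite_V U(1) v]] sub(1)
    by (rule subgroup.m_inv_closed)
  moreover have "set ?zs \<subseteq> insert (inv v) (set ys)"
    by auto
  ultimately have "set ?zs \<subseteq> ?W"
    using ys(1) sub(2) by blast
  moreover have "forces_win ?zs x" if x: "x \<in> ?W" for x
  proof -
    obtain k where "k \<le> ord v" "x \<in> U #> v [^] k"
      using x by (auto simp: set_mult_generate_conv_rcosets[OF finite_V vV])
    then show ?thesis
      by (intro forces_win_alternating[OF U(1) v ys])
  qed
  ultimately show ?thesis
    unfolding winnable_def by blast
qed

lemma winnable_if_hypercentral: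
  assumes "hypercentral_action"
  shows "winnable (carrier V)"
proof -
  let ?\<W> = "{U. invariant_subgroup U \<and> winnable U}"
  have "?\<W> \<subseteq> Pow (carrier V)"
    using subgroup.subset[OF subgroup_if_invariant] by blast
  then have "finite ?\<W>"
    using finite_V by (simp add: finite_subset)
  moreover have "{\<one>} \<in> ?\<W>"
    using invariant_subgroup_one winnable_one by simp
  then have "?\<W> \<noteq> {}"
    by blast
  ultimately obtain U where "U \<in> ?\<W>" and max: "\<forall>W\<in>?\<W>. U \<subseteq> W \<longrightarrow> U = W"
    by (rule finite_has_maximal[THEN bexE])
  then have U: "invariant_subgroup U" "winnable U"
    by simp_all
  have "fixed_mod (carrier G) U \<subseteq> U"
  proof
    fix v assume "v \<in> fixed_mod (carrier G) U"
    then have "U <#> generate V {v} \<in> ?\<W>" "insert v U \<subseteq> U <#> generate V {v}"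
      using U subgroup_if_invariant[OF U(1)] invariant_subgroup_set_mult_generate[OF finite_V]
        winnable_set_mult_generate insert_subset_set_mult_generate
      by (simp_all add: fixed_mod_def)
    then show "v \<in> U"
      using max by auto
  qed
  then have "U = carrier V"
    using assms U(1) by (simp add: hypercentral_action_def)
  then show ?thesis
    using U(2) by simp
qed

theorem winnable_iff_hypercentral: "winnable (carrier V) \<longleftrightarrow> hypercentral_action"
proof
  show "hypercentral_action" if "winnable (carrier V)"
    unfolding hypercentral_action_def
  proof (intro allI impI, rule ccontr)
    fix U assume "invariant_subgroup U" "fixed_mod (carrier G) U \<subseteq> U" "U \<noteq> carrier V"
    then have "\<exists>x\<in>carrier V - U. \<not> forces_win ys x" if "set ys \<subseteq> carrier V" for ys
      using that by (rule exists_position_not_forced)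
    then show False
      using \<open>winnable (carrier V)\<close> unfolding winnable_def by blast
  qed
qed (rule winnable_if_hypercentral)

end


section \<open>Permutations acting on configurations\<close>

definition config_group :: "nat \<Rightarrow> nat \<Rightarrow> (nat \<Rightarrow> nat) monoid" where
  "config_group n m = \<lparr>carrier = Collect (valid_config n m), mult = add_config m, one = (\<lambda>_. 0)\<rparr>"

lemma config_group_simps:
  "x \<in> carrier (config_group n m) \<longleftrightarrow> valid_config n m x"
  "x \<otimes>\<^bsub>config_group n m\<^esub> y = add_config m x y"
  "\<one>\<^bsub>config_group n m\<^esub> = (\<lambda>_. 0)"
  by (simp_all add: config_group_def)

lemma valid_config_less: "valid_config n m x \<Longrightarrow> m > 0 \<Longrightarrow> x i < m"
  by (cases "i \<in> {1..n}") (auto simp: valid_config_def)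

lemma comm_group_config_group:
  assumes "m > 0"
  shows "comm_group (config_group n m)"
proof (rule comm_groupI; simp add: config_group_simps)
  fix x assume x: "valid_config n m x"
  let ?y = "\<lambda>i. (m - x i) mod m"
  have "add_config m ?y x = (\<lambda>_. 0)"
    using valid_config_less[OF x assms]
    by (simp add: add_config_def fun_eq_iff mod_add_left_eq less_imp_le)
  moreover have "valid_config n m ?y"
    using x assms by (auto simp: valid_config_def)
  ultimately show "\<exists>y\<in>carrier (config_group n m). add_config m y x = (\<lambda>_. 0)"
    by (intro bexI[of _ ?y]) (simp_all add: config_group_simps)
next
  fix x assume "valid_config n m x"
  then show "add_config m (\<lambda>_. 0) x = x"
    using valid_config_less assms by (auto simp: add_config_def fun_eq_iff)
qed (use assms in \<open>auto simp: valid_config_def add_config_def fun_eq_iff mod_add_left_eq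
      mod_add_right_eq ac_simps\<close>)

lemma bij_betw_config_group_PiE:
  "bij_betw (\<lambda>x. restrict x {1..n}) (carrier (config_group n m)) ({1..n} \<rightarrow>\<^sub>E {..<m})"
  by (rule bij_betw_byWitness[where f' = "\<lambda>f i. if i \<in> {1..n} then f i else 0"])
     (auto simp: config_group_simps valid_config_def fun_eq_iff PiE_def extensional_def)

lemma order_config_group: "order (config_group n m) = m ^ n"
  using bij_betw_same_card[OF bij_betw_config_group_PiE[of n m]]
  by (simp add: card_PiE order_def)

lemma finite_config_group: "m > 0 \<Longrightarrow> finite (carrier (config_group n m))"
  by (rule card_ge_0_finite) (simp add: order_config_group flip: order_def)

lemma config_group_nat_pow:
  "(x [^]\<^bsub>config_group n m\<^esub> (k :: nat)) i = (k * x i) mod m"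
  by (induction k)
    (simp_all add: nat_pow_def config_group_def add_config_def
      mod_add_left_eq mod_add_right_eq add.commute)

lemma valid_perm_config:
  assumes "s permutes {1..n}" "valid_config n m x"
  shows "valid_config n m (perm_config s x)"
  using assms permutes_in_image[OF permutes_inv[OF assms(1)]]
  unfolding valid_config_def perm_config_def o_def by blast

lemma group_module_config_group:
  assumes "m > 0"
  shows "group_module (config_group n m) (sym_group n) perm_config"
proof -
  interpret comm_group "config_group n m"
    using assms by (rule comm_group_config_group)
  interpret G: group "sym_group n"
    by (rule sym_group_is_group)
  show ?thesis
  proof
    fix s assume "s \<in> carrier (sym_group n)"
    then have "valid_config n m (perm_config s x)" if "valid_config n m x" for x
      using that valid_perm_config by (simp add: sym_group_carrier)
    then show "perm_config s \<in> hom (config_group n m) (config_group n m)"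
      by (auto simp: hom_def config_group_simps perm_config_def add_config_def)
  next
    fix s t and x :: "nat \<Rightarrow> nat" assume "s \<in> carrier (sym_group n)" "t \<in> carrier (sym_group n)"
    then have "bij s" "bij t"
      unfolding sym_group_carrier by (auto dest: permutes_bij)
    then show "perm_config (s \<otimes>\<^bsub>sym_group n\<^esub> t) x = perm_config s (perm_config t x)"
      by (simp add: sym_group_mult perm_config_def o_inv_distrib comp_assoc)
  qed (simp add: sym_group_one perm_config_def)
qed

locale counter_game =
  fixes n m :: nat and S :: "(nat \<Rightarrow> nat) set"
  assumes m_pos: "m > 0"
    and S_perms: "S \<subseteq> carrier (sym_group n)"
    and id_S: "id \<in> S"
begin

abbreviation V where "V \<equiv> config_group n m"
abbreviation G where "G \<equiv> sym_group n\<lparr>carrier := generate (sym_group n) S\<rparr>"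

lemma subgroup_generate_S: "subgroup (generate (sym_group n) S) (sym_group n)"
  using S_perms by (rule group.generate_is_subgroup[OF sym_group_is_group])

sublocale module_game V G perm_config S
proof -
  interpret group_module V G perm_config
    by (intro group_module.group_module_subgroup group_module_config_group m_pos subgroup_generate_S)
  have "generate G S = carrier G"
    using group.generate_consistent[OF sym_group_is_group _ subgroup_generate_S, of S]
    by (simp add: generate.incl subsetI)
  then show "module_game V G perm_config S"
    using finite_config_group[OF m_pos] id_S by unfold_locales (simp_all add: sym_group_one)
qed

lemma forces_win_iff_states:
  "forces_win ys x \<longleftrightarrow>
    (\<forall>ss. length ss = length ys \<and> set ss \<subseteq> S \<longrightarrow> (\<lambda>_. 0) \<in> set (states m x ys ss))"
proof (induction ys arbitrary: x)
  case Nil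
  then show ?case
    by (auto simp: config_group_simps)
next
  case (Cons y ys)
  have "forces_win (y # ys) x \<longleftrightarrow> x = (\<lambda>_. 0) \<or>
      (\<forall>s\<in>S. \<forall>ss. length ss = length ys \<and> set ss \<subseteq> S \<longrightarrow>
        (\<lambda>_. 0) \<in> set (states m (perm_config s (add_config m x y)) ys ss))"
    by (simp add: Cons.IH config_group_simps)
  also have "\<dots> \<longleftrightarrow> (\<forall>s ss. length (s # ss) = length (y # ys) \<and> set (s # ss) \<subseteq> S \<longrightarrow>
        (\<lambda>_. 0) \<in> set (states m x (y # ys) (s # ss)))"
    by auto
  also have "\<dots> \<longleftrightarrow> (\<forall>ss. length ss = length (y # ys) \<and> set ss \<subseteq> S \<longrightarrow>
        (\<lambda>_. 0) \<in> set (states m x (y # ys) ss))"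
    by (auto simp: length_Suc_conv simp del: states.simps)
  finally show ?case .
qed

lemma player_can_win_iff_winnable: "player_can_win n m S \<longleftrightarrow> winnable (carrier V)"
  unfolding player_can_win_def winning_strategy_def winnable_def forces_win_iff_states
    subset_eq Ball_def config_group_simps
  by blast

definition multiples :: "nat \<Rightarrow> (nat \<Rightarrow> nat) set" where
  "multiples q = {v \<in> carrier V. \<forall>i. q dvd v i}"

lemma invariant_subgroup_multiples:
  assumes "q dvd m"
  shows "invariant_subgroup (multiples q)"
  unfolding invariant_subgroup_def
proof (intro conjI ballI subgroupI)
  show "multiples q \<noteq> {}"
    using one_closed by (auto simp: multiples_def config_group_simps(3))
  show "x \<otimes>\<^bsub>V\<^esub> y \<in> multiples q" if "x \<in> multiples q" "y \<in> multiples q" for x y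
  proof -
    have "q dvd (x \<otimes>\<^bsub>V\<^esub> y) i" for i
      using that assms
      by (auto simp: multiples_def config_group_simps(2) add_config_def intro: dvd_mod)
    then show ?thesis
      using that by (simp add: multiples_def)
  qed
  show "inv\<^bsub>V\<^esub> x \<in> multiples q" if "x \<in> multiples q" for x
  proof -
    have x: "x \<in> carrier V" "q dvd x i" for i
      using that by (auto simp: multiples_def)
    have "(x \<otimes>\<^bsub>V\<^esub> inv\<^bsub>V\<^esub> x) i = 0" for i
      using x(1) by (simp add: config_group_simps(3))
    then have "m dvd x i + (inv\<^bsub>V\<^esub> x) i" for i
      by (simp add: config_group_simps(2) add_config_def dvd_eq_mod_eq_0)
    then have "q dvd (inv\<^bsub>V\<^esub> x) i" for i
      using assms x(2) by (meson dvd_add_right_iff dvd_trans)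
    then show ?thesis
      using x(1) by (simp add: multiples_def)
  qed
  show "perm_config g x \<in> multiples q" if "g \<in> carrier G" "x \<in> multiples q" for g x
  proof -
    have "q dvd perm_config g x i" for i
      using that(2) by (simp add: multiples_def perm_config_def)
    then show ?thesis
      using that act_closed[of g x] by (simp add: multiples_def)
  qed
qed (auto simp: multiples_def)

lemma mem_multiples_if_nat_pow_mem:
  assumes "coprime q r" "q dvd m"
    and "v \<in> carrier V" "v [^]\<^bsub>V\<^esub> r \<in> multiples q"
  shows "v \<in> multiples q"
proof -
  have "q dvd r * v i" for i
    using assms(2,4) by (simp add: multiples_def config_group_nat_pow dvd_mod_iff)
  then have "q dvd v i" for i
    using assms(1) by (simp add: coprime_dvd_mult_right_iff)
  then show ?thesis
    using assms(3) by (simp add: multiples_def)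
qed

lemma eq_id_if_displacement_multiples:
  assumes "g \<in> carrier G" "q \<noteq> 1" "q dvd m"
    and trivial: "\<And>v. v \<in> carrier V \<Longrightarrow> displacement g v \<in> multiples q"
  shows "g = id"
proof (rule ccontr)
  assume "g \<noteq> id"
  then obtain i where i: "g i \<noteq> i"
    by (auto simp: fun_eq_iff)
  have g: "g permutes {1..n}"
    using assms(1) subgroup.mem_carrier[OF subgroup_generate_S] by (simp add: sym_group_carrier)
  then have "i \<in> {1..n}"
    using i by (metis permutes_not_in)
  define v :: "nat \<Rightarrow> nat" where "v = (\<lambda>j. if j = i then 1 else 0)"
  have "m > 1"
    using assms(2,3) m_pos by (cases "m = 1") auto
  then have v: "v \<in> carrier V"
    using \<open>i \<in> {1..n}\<close> by (auto simp: config_group_simps valid_config_def v_def)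
  have "(displacement g v \<otimes>\<^bsub>V\<^esub> v) (g i) = perm_config g v (g i)"
    using displacement_mult_self[OF assms(1) v] by simp
  then have "displacement g v (g i) mod m = 1"
    using i permutes_inverses(2)[OF g]
    by (simp add: config_group_simps add_config_def perm_config_def v_def)
  moreover have "q dvd displacement g v (g i) mod m"
    using trivial[OF v] assms(3) by (simp add: multiples_def dvd_mod)
  ultimately show False
    using assms(2) by simp
qed

lemma finite_G: "finite (carrier G)"
  using finite_permutations[of "{1..n}"] subgroup.subset[OF subgroup_generate_S]
  by (auto simp: sym_group_def intro: finite_subset)

theorem hypercentral_action_imp_same_prime:
  assumes "hypercentral_action" and q: "prime q" "q dvd m" and r: "prime r" "r dvd order G"
  shows "r = q"
proof (rule ccontr)
  assume "r \<noteq> q"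
  then have "coprime q r"
    using q(1) r(1) by (metis primes_coprime)
  obtain g where g: "g \<in> carrier G" "g \<noteq> id" "g \<in> torsion r"
    using G.cauchy_element[OF finite_G r] by (auto simp: torsion_def sym_group_one)
  have "displacement g v \<in> multiples q" if "v \<in> carrier V" for v
    using hypercentral_action_torsion_trivial[OF assms(1) invariant_subgroup_multiples[OF q(2)]]
      mem_multiples_if_nat_pow_mem[OF \<open>coprime q r\<close> q(2)] g(3) that by blast
  then have "g = id"
    using q by (intro eq_id_if_displacement_multiples[OF g(1)]) auto
  then show False
    using g(2) by blast
qed

theorem hypercentral_action_iff:
  "hypercentral_action \<longleftrightarrow> order G = 1 \<or> m = 1 \<or>
    (\<exists>p a b. prime p \<and> a > 0 \<and> b > 0 \<and> order G = p ^ a \<and> m = p ^ b)" (is "_ \<longleftrightarrow> ?cond")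
proof
  show ?cond if "hypercentral_action"
  proof (cases "order G = 1 \<or> m = 1")
    case False
    then show ?thesis
      using hypercentral_action_imp_same_prime[OF that] G.order_gt_0_iff_finite finite_G m_pos
      by (intro disjI2 powers_of_same_prime_if_same_prime_divisors) auto
  qed blast
next
  assume ?cond
  then consider "order G = 1" | "m = 1" | p a b where "prime p" "order G = p ^ a" "m = p ^ b"
    by blast
  then show "hypercentral_action"
  proof cases
    case 1
    then show ?thesis
      by (rule hypercentral_action_if_trivial_group)
  next
    case 2
    then show ?thesis
      by (intro hypercentral_action_if_trivial_module) (simp add: order_config_group)
  next
    case 3
    then show ?thesis
      by (intro hypercentral_action_if_p_groups)
        (auto simp: order_config_group simp flip: power_mult)
  qed
qed

end

theorem theorem1p2:
  fixes n m :: nat and S :: "(nat \<Rightarrow> nat) set"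
  assumes "n > 0" and "m > 0"
    and "S \<subseteq> carrier (sym_group n)" and "id \<in> S"
  shows "player_can_win n m S \<longleftrightarrow>
    (card (generate (sym_group n) S) = 1 \<or> m = 1 \<or>
     (\<exists>p a b. prime p \<and> a > 0 \<and> b > 0 \<and>
        card (generate (sym_group n) S) = p ^ a \<and> m = p ^ b))"
proof -
  interpret counter_game n m S
    using assms by unfold_locales
  have "player_can_win n m S \<longleftrightarrow> winnable (carrier V)"
    by (rule player_can_win_iff_winnable)
  also have "\<dots> \<longleftrightarrow> hypercentral_action"
    by (rule winnable_iff_hypercentral)
  also have "\<dots> \<longleftrightarrow> order G = 1 \<or> m = 1 \<or>
      (\<exists>p a b. prime p \<and> a > 0 \<and> b > 0 \<and> order G = p ^ a \<and> m = p ^ b)"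
    by (rule hypercentral_action_iff)
  finally show ?thesis
    by (simp add: order_def)
qed

end
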